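(* Let $M$ be a compact connected complex manifold of complex dimension $n\ge 2$, let $\omega,\chi$ be Hermitian metrics on $M$, let $F\in C^\infty(M,\mathbb R)$, and let $0<T<\infty$. Let $\underline\varphi,\overline\varphi\in C^\infty(M\times[0,T],\mathbb R)$ be admissible, i.e. $\underline\varphi(\cdot,t),\overline\varphi(\cdot,t)\in\mathcal H_\chi$ for every $t\in[0,T]$, and suppose that on $M\times[0,T]$ $$\partial_t\underline\varphi\le\mathcal Q_F(\underline\varphi),\qquad \partial_t\overline\varphi\ge\mathcal Q_F(\overline\varphi).$$ If $\underline\varphi(\cdot,0)\le\overline\varphi(\cdot,0)$ on $M$, then $\underline\varphi\le\overline\varphi$ on $M\times[0,T]$.
   Context: Hermitian metrics are identified with their positive real $(1,1)$-forms; no closedness is assumed. $\mathcal H_\chi=\{\varphi\in C^\infty(M,\mathbb R):\chi_\varphi:=\chi+\sqrt{-1}\,\partial\bar\partial\varphi>0\}$. For $\varphi\in\mathcal H_\chi$, $$\mathcal Q_F(\varphi)=\log\frac{\chi_\varphi^n}{\omega\wedge\chi_\varphi^{n-1}}+F=\log n-\log\operatorname{tr}_{\chi_\varphi}\omega+F.$$ For time-dependent functions $\mathcal Q_F$ is applied at each fixed time. *)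

theory Defs
  imports "HOL-Analysis.Analysis"
begin

section \<open>Smooth and holomorphic maps between vector spaces\<close>

text \<open>On an open subset of a finite-dimensional space, \<open>Ck_on k\<close> is the usual class \<open>C\<^sup>k\<close>.\<close>

primrec Ck_on ::
  "nat \<Rightarrow> 'a set \<Rightarrow> ('a::real_normed_vector \<Rightarrow> 'b::real_normed_vector) \<Rightarrow> bool"
where
  "Ck_on 0 W f \<longleftrightarrow> continuous_on W f"
| "Ck_on (Suc k) W f \<longleftrightarrow>
     (\<forall>x\<in>W. f differentiable (at x)) \<and> (\<forall>v. Ck_on k W (\<lambda>x. frechet_derivative f (at x) v))"

text \<open>Smoothness on an arbitrary set \<open>S\<close> means local extendability to a smooth function on an open
  set. For open \<open>S\<close> this is ordinary smoothness; for \<open>S = V \<times> [0,T]\<close> it is smoothness up to the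
  boundary times \<open>0\<close> and \<open>T\<close>.\<close>

definition smooth_on :: "'a set \<Rightarrow> ('a::real_normed_vector \<Rightarrow> 'b::real_normed_vector) \<Rightarrow> bool"
where
  "smooth_on S f \<longleftrightarrow>
     (\<forall>x\<in>S. \<exists>W g. open W \<and> x \<in> W \<and> (\<forall>k. Ck_on k W g) \<and> (\<forall>y\<in>W \<inter> S. g y = f y))"

definition holo_on :: "(complex^'n) set \<Rightarrow> (complex^'n \<Rightarrow> complex^'m) \<Rightarrow> bool" where
  "holo_on S f \<longleftrightarrow>
     (\<forall>z\<in>S. \<exists>L. (f has_derivative L) (at z) \<and> (\<forall>c v. L (c *s v) = c *s L v))"

text \<open>The Wirtinger operators \<open>\<partial>/\<partial>z\<^sub>i = (\<partial>/\<partial>x\<^sub>i - \<i> \<partial>/\<partial>y\<^sub>i)/2\<close> and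
  \<open>\<partial>/\<partial>zbar\<^sub>i = (\<partial>/\<partial>x\<^sub>i + \<i> \<partial>/\<partial>y\<^sub>i)/2\<close>.\<close>

definition d_z :: "'n \<Rightarrow> (complex^'n \<Rightarrow> complex) \<Rightarrow> complex^'n \<Rightarrow> complex" where
  "d_z i f z =
     (frechet_derivative f (at z) (axis i 1) - \<i> * frechet_derivative f (at z) (axis i \<i>)) / 2"

definition d_zbar :: "'n \<Rightarrow> (complex^'n \<Rightarrow> complex) \<Rightarrow> complex^'n \<Rightarrow> complex" where
  "d_zbar i f z =
     (frechet_derivative f (at z) (axis i 1) + \<i> * frechet_derivative f (at z) (axis i \<i>)) / 2"

section \<open>Complex manifolds\<close>

text \<open>The manifold is a whole type \<open>'m\<close> with a holomorphic atlas; its complex dimension is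
  \<open>CARD('n)\<close>. A chart is a domain together with a coordinate map, of which only the values on the
  domain matter.\<close>

type_synonym ('m, 'n) chart = "'m set \<times> ('m \<Rightarrow> complex^'n)"

definition chart_image :: "('m, 'n) chart \<Rightarrow> (complex^'n) set" where
  "chart_image c = snd c ` fst c"

definition chart_inv :: "('m, 'n) chart \<Rightarrow> complex^'n \<Rightarrow> 'm" where
  "chart_inv c = inv_into (fst c) (snd c)"

definition transition :: "('m, 'n) chart \<Rightarrow> ('m, 'n) chart \<Rightarrow> complex^'n \<Rightarrow> complex^'n" where
  "transition c d = snd d \<circ> chart_inv c"

definition complex_atlas ::
  "('m::{t2_space,second_countable_topology}, 'n::finite) chart set \<Rightarrow> bool"
where
  "complex_atlas A \<longleftrightarrow>
     (\<forall>c\<in>A. open (fst c) \<and> open (chart_image c) \<and>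
        homeomorphism (fst c) (chart_image c) (snd c) (chart_inv c)) \<and>
     (\<Union>c\<in>A. fst c) = UNIV \<and>
     (\<forall>c\<in>A. \<forall>d\<in>A. holo_on (snd c ` (fst c \<inter> fst d)) (transition c d))"

definition chart_at :: "('m, 'n) chart set \<Rightarrow> 'm \<Rightarrow> ('m, 'n) chart" where
  "chart_at A p = (SOME c. c \<in> A \<and> p \<in> fst c)"

definition smooth_fun :: "('m, 'n::finite) chart set \<Rightarrow> ('m \<Rightarrow> real) \<Rightarrow> bool" where
  "smooth_fun A f \<longleftrightarrow> (\<forall>c\<in>A. smooth_on (chart_image c) (f \<circ> chart_inv c))"

definition smooth_time_fun ::
  "('m, 'n::finite) chart set \<Rightarrow> real \<Rightarrow> ('m \<Rightarrow> real \<Rightarrow> real) \<Rightarrow> bool"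
where
  "smooth_time_fun A T u \<longleftrightarrow>
     (\<forall>c\<in>A. smooth_on (chart_image c \<times> {0..T}) (\<lambda>(z, t). u (chart_inv c z) t))"

text \<open>The derivative is one-sided at the endpoints of \<open>[0,T]\<close>.\<close>

definition time_deriv :: "real \<Rightarrow> ('m \<Rightarrow> real \<Rightarrow> real) \<Rightarrow> 'm \<Rightarrow> real \<Rightarrow> real" where
  "time_deriv T u p t = vector_derivative (u p) (at t within {0..T})"

section \<open>Real (1,1)-forms and Hermitian metrics\<close>

text \<open>A (1,1)-form \<open>\<alpha>\<close> is given by its coefficient matrices: over a chart \<open>c\<close> with coordinates \<open>z\<close>,
  \<open>\<alpha> = \<i> \<Sum>\<^sub>i\<^sub>j (\<alpha> c p)\<^sub>i\<^sub>j dz\<^sub>i \<and> dzbar\<^sub>j\<close> at \<open>p\<close>. The form is real iff these matrices are Hermitian.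
  The last clause of \<open>real_form11\<close> is the pullback rule: with \<open>w\<close> the coordinates of \<open>d\<close>, the vector
  \<open>J i\<close> below has components \<open>\<partial>w\<^sub>k/\<partial>z\<^sub>i\<close>.\<close>

type_synonym ('m, 'n) form11 = "('m, 'n) chart \<Rightarrow> 'm \<Rightarrow> complex^'n^'n"

definition hermitian_matrix :: "complex^'n^'n \<Rightarrow> bool" where
  "hermitian_matrix H \<longleftrightarrow> (\<forall>i j. H $ j $ i = cnj (H $ i $ j))"

definition pos_def_matrix :: "complex^'n^'n \<Rightarrow> bool" where
  "pos_def_matrix H \<longleftrightarrow> hermitian_matrix H \<and>
     (\<forall>v. v \<noteq> 0 \<longrightarrow> 0 < Re (\<Sum>i\<in>UNIV. \<Sum>j\<in>UNIV. H $ i $ j * v $ i * cnj (v $ j)))"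

definition real_form11 :: "('m, 'n::finite) chart set \<Rightarrow> ('m, 'n) form11 \<Rightarrow> bool" where
  "real_form11 A \<alpha> \<longleftrightarrow>
     (\<forall>c\<in>A. smooth_on (chart_image c) (\<alpha> c \<circ> chart_inv c) \<and>
        (\<forall>p\<in>fst c. hermitian_matrix (\<alpha> c p))) \<and>
     (\<forall>c\<in>A. \<forall>d\<in>A. \<forall>p\<in>fst c \<inter> fst d.
        let J = (\<lambda>i. frechet_derivative (transition c d) (at (snd c p)) (axis i 1)) in
        \<forall>i j. \<alpha> c p $ i $ j =
          (\<Sum>k\<in>UNIV. \<Sum>l\<in>UNIV. \<alpha> d p $ k $ l * J i $ k * cnj (J j $ l)))"

definition positive_form11 :: "('m, 'n::finite) chart set \<Rightarrow> ('m, 'n) form11 \<Rightarrow> bool" where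
  "positive_form11 A \<alpha> \<longleftrightarrow> (\<forall>c\<in>A. \<forall>p\<in>fst c. pos_def_matrix (\<alpha> c p))"

definition hermitian_metric :: "('m, 'n::finite) chart set \<Rightarrow> ('m, 'n) form11 \<Rightarrow> bool" where
  "hermitian_metric A \<alpha> \<longleftrightarrow> real_form11 A \<alpha> \<and> positive_form11 A \<alpha>"

text \<open>The form \<open>\<i> \<partial> \<partial>bar f\<close>, whose coefficients are \<open>\<partial>\<^sup>2f/\<partial>z\<^sub>i\<partial>zbar\<^sub>j\<close>.\<close>

definition i_ddbar :: "('m \<Rightarrow> real) \<Rightarrow> ('m, 'n::finite) form11" where
  "i_ddbar f c p =
     (\<chi> i j. d_z i (d_zbar j (\<lambda>z. complex_of_real (f (chart_inv c z)))) (snd c p))"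

definition form_add_ddbar ::
  "('m, 'n::finite) form11 \<Rightarrow> ('m \<Rightarrow> real) \<Rightarrow> ('m, 'n) form11"
where
  "form_add_ddbar X f c p = X c p + i_ddbar f c p"

definition admissible ::
  "('m, 'n::finite) chart set \<Rightarrow> ('m, 'n) form11 \<Rightarrow> ('m \<Rightarrow> real) set"
where
  "admissible A X = {f. smooth_fun A f \<and> positive_form11 A (form_add_ddbar X f)}"

section \<open>Top-degree wedge products and the operator\<close>

text \<open>For (1,1)-forms \<open>\<alpha>\<^sub>k = \<i> \<Sum>\<^sub>i\<^sub>j (B k)\<^sub>i\<^sub>j dz\<^sub>i \<and> dzbar\<^sub>j\<close>, one for each of the \<open>n = CARD('n)\<close> indices
  \<open>k\<close>, expand \<open>\<alpha>\<^sub>1 \<and> \<dots> \<and> \<alpha>\<^sub>n\<close> multilinearly. A term \<open>\<And>\<^sub>k \<i> dz\<^bsub>p k\<^esub> \<and> dzbar\<^bsub>q k\<^esub>\<close> vanishes unless \<open>p\<close>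
  and \<open>q\<close> are permutations, and is then \<open>sign p * sign q\<close> times \<open>\<And>\<^sub>k \<i> dz\<^sub>k \<and> dzbar\<^sub>k\<close>. So \<open>wedge_top B\<close>
  is the coefficient of \<open>\<alpha>\<^sub>1 \<and> \<dots> \<and> \<alpha>\<^sub>n\<close> with respect to that volume form.\<close>

definition wedge_top :: "('n::finite \<Rightarrow> complex^'n^'n) \<Rightarrow> complex" where
  "wedge_top B =
     (\<Sum>p | p permutes (UNIV::'n set). \<Sum>q | q permutes (UNIV::'n set).
        of_int (sign p * sign q) * (\<Prod>k\<in>UNIV. B k $ p k $ q k))"

definition wedge_power :: "complex^'n^'n \<Rightarrow> complex" where
  "wedge_power G = wedge_top (\<lambda>k::'n::finite. G)"

text \<open>The coefficient of \<open>\<omega> \<and> \<chi>\<^sup>n\<^sup>-\<^sup>1\<close>, where \<open>\<omega>\<close> may occupy any slot because 2-forms commute.\<close>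

definition wedge_power1 :: "complex^'n^'n \<Rightarrow> complex^'n^'n \<Rightarrow> complex" where
  "wedge_power1 W G = wedge_top ((\<lambda>k::'n::finite. G)((SOME k. True) := W))"

text \<open>\<open>X\<close> is the background metric usually called \<open>\<chi>\<close>, a letter that is binder syntax in
  \<open>HOL-Analysis\<close>. The quotient of the two top-degree forms is a function on the manifold, so it may be computed
  in any chart around the point.\<close>

definition Q_op ::
  "('m, 'n::finite) chart set \<Rightarrow> ('m, 'n) form11 \<Rightarrow> ('m, 'n) form11 \<Rightarrow> ('m \<Rightarrow> real) \<Rightarrow>
   ('m \<Rightarrow> real) \<Rightarrow> 'm \<Rightarrow> real"
where
  "Q_op A \<omega> X F f p =
     (let c = chart_at A p; G = form_add_ddbar X f c p
      in ln (Re (wedge_power G / wedge_power1 (\<omega> c p) G)) + F p)"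

lemma wedge_top_det:
  fixes B :: "'n::finite \<Rightarrow> complex^'n^'n"
  shows "wedge_top B = (\<Sum>p | p permutes (UNIV::'n set). det (\<chi> i. B (inv p i) $ i))"
  unfolding wedge_top_def
proof (rule sum.cong[OF refl])
  fix p :: "'n \<Rightarrow> 'n" assume "p \<in> {p. p permutes UNIV}"
  then have p: "p permutes UNIV" by simp
  define D :: "complex^'n^'n" where "D = (\<chi> i. B (inv p i) $ i)"
  have "(\<chi> i. B i $ p i) = (\<chi> i. D $ p i)"
    by (simp add: D_def vec_eq_iff permutes_inverses[OF p])
  then have "det (\<chi> i. B i $ p i) = of_int (sign p) * det D"
    using det_permute_rows[OF p, of D] by simp
  moreover have "(of_int (sign p) :: complex) * of_int (sign p) = 1"
    by (metis of_int_1 of_int_mult sign_idempotent)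
  ultimately have D: "det D = of_int (sign p) * det (\<chi> i. B i $ p i)"
    by (simp add: mult.assoc[symmetric])
  show "(\<Sum>q | q permutes UNIV. of_int (sign p * sign q) * (\<Prod>k\<in>UNIV. B k $ p k $ q k))
      = det (\<chi> i. B (inv p i) $ i)"
    unfolding D_def[symmetric] D by (simp add: det_def sum_distrib_left mult.assoc)
qed

lemma wedge_power_eq:
  fixes G :: "complex^'n::finite^'n"
  shows "wedge_power G = fact CARD('n) * det G"
  by (simp add: wedge_power_def wedge_top_det card_permutations)

lemma det_replace_row:
  fixes G W :: "complex^'n::finite^'n"
  assumes "det G \<noteq> 0"
  shows "det (\<chi> i. if i = k then W $ k else G $ i) = (W ** matrix_inv G) $ k $ k * det G"
proof -
  define x where "x = (W ** matrix_inv G) $ k"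
  have inv: "matrix_inv G ** G = mat 1"
    using assms unfolding invertible_det_nz[symmetric] invertible_def matrix_inv_def
    by (rule someI2_ex) simp
  have "W $ k = ((W ** matrix_inv G) ** G) $ k"
    by (simp add: matrix_mul_assoc[symmetric] inv)
  also have "\<dots> = (\<Sum>i\<in>UNIV. x $ i *s row i G)"
    by (simp add: vec_eq_iff x_def matrix_matrix_mult_def row_def)
  finally have W: "W $ k = (\<Sum>i\<in>UNIV. x $ i *s row i G)" .
  have "row i G = G $ i" for i
    by (simp add: vec_eq_iff row_def)
  then show ?thesis
    using cramer_lemma_transpose[where x = x and A = G and k = k] unfolding W[symmetric]
    by (simp add: x_def cong: if_cong)
qed

lemma wedge_power1_eq:
  fixes G W :: "complex^'n::finite^'n"
  assumes "det G \<noteq> 0"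
  shows "of_nat CARD('n) * wedge_power1 W G = fact CARD('n) * det G * trace (matrix_inv G ** W)"
proof -
  define h where "h = (\<lambda>k. (W ** matrix_inv G) $ k $ k * det G)"
  define k0 :: 'n where "k0 = (SOME k. True)"
  have eq: "wedge_power1 W G = (\<Sum>p | p permutes (UNIV::'n set). h (p k0))"
    unfolding wedge_power1_def wedge_top_det k0_def[symmetric]
  proof (rule sum.cong[OF refl])
    fix p :: "'n \<Rightarrow> 'n" assume "p \<in> {p. p permutes UNIV}"
    then have p: "p permutes UNIV" by simp
    have "(\<chi> i. ((\<lambda>k. G)(k0 := W)) (inv p i) $ i) = (\<chi> i. if i = p k0 then W $ p k0 else G $ i)"
      by (auto simp: vec_eq_iff permutes_inverses[OF p])
    then show "det (\<chi> i. ((\<lambda>k. G)(k0 := W)) (inv p i) $ i) = h (p k0)"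
      by (simp add: det_replace_row[OF assms] h_def)
  qed
  have slot: "(\<Sum>p | p permutes (UNIV::'n set). h (p k)) = wedge_power1 W G" for k
  proof -
    have "Transposition.transpose k0 k permutes (UNIV::'n set)"
      by (rule permutes_swap_id) auto
    from sum_permutations_compose_right[OF this, of "\<lambda>p. h (p k)"]
    show ?thesis by (simp add: eq)
  qed
  have "of_nat CARD('n) * wedge_power1 W G
      = (\<Sum>k\<in>UNIV. \<Sum>p | p permutes (UNIV::'n set). h (p k))"
    by (simp add: slot)
  also have "\<dots> = (\<Sum>p | p permutes (UNIV::'n set). \<Sum>k\<in>UNIV. h (p k))"
    by (rule sum.swap)
  also have "\<dots> = (\<Sum>p | p permutes (UNIV::'n set). \<Sum>k\<in>UNIV. h k)"
  proof (rule sum.cong[OF refl])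
    fix p :: "'n \<Rightarrow> 'n" assume "p \<in> {p. p permutes UNIV}"
    then show "(\<Sum>k\<in>UNIV. h (p k)) = (\<Sum>k\<in>UNIV. h k)"
      using sum.permute[of p UNIV h] by (simp add: o_def)
  qed
  also have "\<dots> = fact CARD('n) * (det G * trace (W ** matrix_inv G))"
    by (simp add: card_permutations h_def trace_def sum_distrib_left mult.commute)
  finally show ?thesis
    by (simp add: trace_mul_sym[of W] mult.assoc)
qed

text \<open>Hence, wherever \<open>X + \<i> \<partial> \<partial>bar f\<close> is positive, \<open>Q_op\<close> is also \<open>log n - log tr \<omega> + F\<close>, with the
  trace taken with respect to that form.\<close>

theorem wedge_quotient_eq_trace:
  fixes G W :: "complex^'n::finite^'n"
  assumes "det G \<noteq> 0"
  shows "wedge_power G / wedge_power1 W G = of_nat CARD('n) / trace (matrix_inv G ** W)"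
proof -
  have "wedge_power1 W G = fact CARD('n) * det G * trace (matrix_inv G ** W) / of_nat CARD('n)"
    using wedge_power1_eq[OF assms, of W] by (simp add: field_simps)
  then show ?thesis
    using assms by (simp add: wedge_power_eq)
qed

end

theory Submission
  imports Defs
begin

text \<open>If \<open>u > v\<close> somewhere, then for small \<open>\<epsilon> > 0\<close> the function \<open>u - v - \<epsilon> t\<close> has a positive maximum
  at some \<open>(p, t)\<close> with \<open>t > 0\<close>. There \<open>\<partial>\<^sub>t u - \<partial>\<^sub>t v \<ge> \<epsilon>\<close>, while \<open>\<i> \<partial> \<partial>bar u \<le> \<i> \<partial> \<partial>bar v\<close>. Since the
  trace of \<open>\<omega>\<close> with respect to a positive form is antitone in that form, the operator at \<open>u\<close> is at
  most the operator at \<open>v\<close>, which contradicts the two differential inequalities. Monotonicity of the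
  trace is reduced to that of the forms \<open>x \<mapsto> x\<^sup>* G\<^sup>-\<^sup>1 x\<close> by writing \<open>\<omega>\<close> as a sum of rank one
  matrices \<open>x x\<^sup>*\<close>.\<close>

section \<open>Positive definite Hermitian matrices\<close>

definition herm_prod :: "complex^'n \<Rightarrow> complex^'n \<Rightarrow> complex" where
  "herm_prod x y = (\<Sum>i\<in>UNIV. cnj (x $ i) * y $ i)"

lemma herm_prod_diff_left: "herm_prod (x - y) z = herm_prod x z - herm_prod y z"
  and herm_prod_diff_right: "herm_prod x (y - z) = herm_prod x y - herm_prod x z"
  by (simp_all add: herm_prod_def algebra_simps sum_subtractf)

lemma cnj_herm_prod: "cnj (herm_prod x y) = herm_prod y x"
  by (simp add: herm_prod_def mult.commute)

lemma herm_prod_axis_left: "herm_prod (axis k c) y = cnj c * y $ k"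
  by (simp add: herm_prod_def axis_def if_distrib[of cnj] if_distrib[of "\<lambda>x. x * _"] cong: if_cong)

lemma matrix_vector_mult_axis: "(H *v axis k c) $ i = H $ i $ k * c"
  by (simp add: matrix_vector_mult_def axis_def if_distrib[of "\<lambda>x. _ * x"] cong: if_cong)

lemma herm_prod_adjoint:
  assumes "hermitian_matrix H"
  shows "herm_prod (H *v x) y = herm_prod x (H *v y)"
proof -
  have cnj: "cnj (H $ i $ j) = H $ j $ i" for i j
    using assms unfolding hermitian_matrix_def by (metis complex_cnj_cnj)
  have "herm_prod (H *v x) y = (\<Sum>i\<in>UNIV. \<Sum>j\<in>UNIV. H $ j $ i * cnj (x $ j) * y $ i)"
    by (simp add: cnj herm_prod_def matrix_vector_mult_def sum_distrib_right)
  also have "\<dots> = (\<Sum>j\<in>UNIV. \<Sum>i\<in>UNIV. H $ j $ i * cnj (x $ j) * y $ i)"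
    by (rule sum.swap)
  also have "\<dots> = herm_prod x (H *v y)"
    by (simp add: herm_prod_def matrix_vector_mult_def sum_distrib_left mult_ac)
  finally show ?thesis .
qed

lemma Im_herm_form:
  assumes "hermitian_matrix H"
  shows "Im (herm_prod x (H *v x)) = 0"
proof -
  have "cnj (herm_prod x (H *v x)) = herm_prod x (H *v x)"
    using assms by (simp add: cnj_herm_prod herm_prod_adjoint)
  then show ?thesis by (simp add: complex_eq_iff)
qed

text \<open>\<open>pos_def_matrix\<close> pairs \<open>v $ i\<close> with
  \<open>cnj (v $ j)\<close>, the opposite convention to \<open>herm_prod\<close>. Conjugating the
  vector entrywise translates between the two.\<close>

lemma herm_form_eq:
  "herm_prod x (H *v x) =
     (\<Sum>i\<in>UNIV. \<Sum>j\<in>UNIV. H $ i $ j * (\<chi> i. cnj (x $ i)) $ i * cnj ((\<chi> i. cnj (x $ i)) $ j))"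
  by (simp add: herm_prod_def matrix_vector_mult_def sum_distrib_left mult_ac)

lemma pos_def_hermitian: "pos_def_matrix H \<Longrightarrow> hermitian_matrix H"
  by (simp add: pos_def_matrix_def)

lemma pos_def_form:
  assumes "pos_def_matrix H" "x \<noteq> 0"
  shows "0 < Re (herm_prod x (H *v x))"
proof -
  have "(\<chi> i. cnj (x $ i)) \<noteq> 0"
    using assms(2) by (simp add: vec_eq_iff)
  then show ?thesis
    using assms(1) unfolding pos_def_matrix_def herm_form_eq by blast
qed

lemma pos_def_form_ge_0:
  assumes "pos_def_matrix H"
  shows "0 \<le> Re (herm_prod x (H *v x))"
proof (cases "x = 0")
  case True
  then show ?thesis by (simp add: herm_prod_def)
qed (use pos_def_form[OF assms] in \<open>auto intro: less_imp_le\<close>)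

lemma pos_def_det_nz:
  assumes "pos_def_matrix H"
  shows "det H \<noteq> 0"
proof -
  have "x = 0" if "H *v x = 0" for x
    using pos_def_form[OF assms, of x] that by (auto simp: herm_prod_def)
  then show ?thesis
    using matrix_left_invertible_ker[of H] invertible_left_inverse[of H]
    by (auto simp: invertible_det_nz[symmetric])
qed

text \<open>Gaussian elimination: a Schur complement removes one index from the support.\<close>

lemma rank_one_decomposition_supported:
  fixes W :: "complex^'n::finite^'n"
  assumes "finite S" "hermitian_matrix W"
    and "\<And>i j. i \<notin> S \<or> j \<notin> S \<Longrightarrow> W $ i $ j = 0"
    and "\<And>x. (\<And>i. i \<notin> S \<Longrightarrow> x $ i = 0) \<Longrightarrow> x \<noteq> 0 \<Longrightarrow> 0 < Re (herm_prod x (W *v x))"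
  shows "\<exists>x :: 'n \<Rightarrow> complex^'n. \<forall>i j. W $ i $ j = (\<Sum>k\<in>S. x k $ i * cnj (x k $ j))"
  using assms
proof (induction S arbitrary: W rule: finite_induct)
  case empty
  then show ?case by simp
next
  case (insert k S)
  have cnjW: "cnj (W $ i $ j) = W $ j $ i" for i j
    using insert.prems(1) unfolding hermitian_matrix_def by (metis complex_cnj_cnj)
  define a where "a = Re (W $ k $ k)"
  have Wkk: "W $ k $ k = of_real a"
    using cnjW[of k k] by (simp add: a_def complex_eq_iff)
  have a: "0 < a"
    using insert.prems(3)[of "axis k 1"]
    by (simp add: herm_prod_axis_left matrix_vector_mult_axis a_def) (simp add: axis_def vec_eq_iff)
  \<comment> \<open>Subtracting this rank one matrix, built from column \<open>k\<close> and the
    pivot \<open>a\<close>, clears row and column \<open>k\<close>.\<close>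
  define V :: "complex^'n^'n" where "V = (\<chi> i j. W $ i $ j - W $ i $ k * W $ k $ j / of_real a)"
  have V_mult: "(V *v x) $ i = (W *v x) $ i - W $ i $ k * (W *v x) $ k / of_real a" for x i
    by (simp add: V_def matrix_vector_mult_def algebra_simps sum_subtractf sum_distrib_left
        sum_divide_distrib)
  have "\<exists>x :: 'n \<Rightarrow> complex^'n. \<forall>i j. V $ i $ j = (\<Sum>k\<in>S. x k $ i * cnj (x k $ j))"
  proof (rule insert.IH)
    show "hermitian_matrix V"
      by (simp add: hermitian_matrix_def V_def cnjW mult.commute)
  next
    fix i j assume "i \<notin> S \<or> j \<notin> S"
    then consider "i = k" | "j = k" | "i \<notin> insert k S" | "j \<notin> insert k S" by auto
    then show "V $ i $ j = 0"
      using a insert.prems(2) by cases (auto simp: V_def Wkk)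
  next
    fix x :: "complex^'n" assume x: "\<And>i. i \<notin> S \<Longrightarrow> x $ i = 0" "x \<noteq> 0"
    \<comment> \<open>Completing the square: \<open>y\<close> is \<open>x\<close> shifted along
      \<open>axis k 1\<close> so that \<open>(W *v y) $ k = 0\<close>. The form of \<open>W\<close>
      at \<open>y\<close> then equals that of \<open>V\<close> at \<open>x\<close>, and
      \<open>y\<close> is nonzero because the shift only touches the index \<open>k\<close>, where
      \<open>x\<close> vanishes.\<close>
    define b where "b = (W *v x) $ k"
    define y where "y = x - axis k (b / of_real a)"
    obtain i where i: "x $ i \<noteq> 0" using x(2) by (auto simp: vec_eq_iff)
    with x(1) insert.hyps have "i \<noteq> k" by auto
    with i have "y $ i \<noteq> 0" by (simp add: y_def axis_def)
    then have "y \<noteq> 0" by (auto simp: vec_eq_iff)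
    moreover have "y $ i = 0" if "i \<notin> insert k S" for i
      using that x(1) by (auto simp: y_def axis_def)
    ultimately have pos: "0 < Re (herm_prod y (W *v y))"
      using insert.prems(3) by blast
    have Wx: "herm_prod x (W *v axis k c) = cnj b * c" for c
      by (simp add: herm_prod_adjoint[OF insert.prems(1), symmetric])
        (metis b_def cnj_herm_prod herm_prod_axis_left complex_cnj_cnj complex_cnj_mult mult.commute)
    have "herm_prod y (W *v y) = herm_prod x (W *v x) - cnj b * b / of_real a"
      using a by (simp add: y_def matrix_vector_mult_diff_distrib herm_prod_diff_left
          herm_prod_diff_right Wx herm_prod_axis_left matrix_vector_mult_axis Wkk b_def[symmetric]
          field_simps)
    also have "\<dots> = herm_prod x (V *v x)"
    proof -
      have "cnj b = (\<Sum>i\<in>UNIV. cnj (x $ i) * W $ i $ k)"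
        by (simp add: b_def matrix_vector_mult_def cnjW mult.commute)
      then show ?thesis
        by (simp add: herm_prod_def V_mult b_def[symmetric] right_diff_distrib sum_subtractf
            sum_distrib_right sum_distrib_left sum_divide_distrib mult_ac)
    qed
    finally show "0 < Re (herm_prod x (V *v x))" using pos by simp
  qed
  then obtain x :: "'n \<Rightarrow> complex^'n"
    where x: "\<And>i j. V $ i $ j = (\<Sum>k\<in>S. x k $ i * cnj (x k $ j))" by blast
  \<comment> \<open>The pivot column, scaled by \<open>sqrt a\<close> so that \<open>z\<close> times
    its conjugate transpose is exactly the matrix subtracted in \<open>V\<close>.\<close>
  define z :: "complex^'n" where "z = (\<chi> i. W $ i $ k / of_real (sqrt a))"
  have "z $ i * cnj (z $ j) = W $ i $ k * W $ k $ j / of_real a" for i j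
  proof -
    have "complex_of_real (sqrt a) * of_real (sqrt a) = of_real a"
      using a by (simp flip: of_real_mult)
    then show ?thesis by (simp add: z_def cnjW)
  qed
  then have "W $ i $ j = z $ i * cnj (z $ j) + V $ i $ j" for i j
    by (simp add: V_def)
  then have "W $ i $ j = (\<Sum>l\<in>insert k S. (x(k := z)) l $ i * cnj ((x(k := z)) l $ j))" for i j
    using insert.hyps x by (auto intro!: sum.cong)
  then show ?case by blast
qed

lemma pos_def_rank_one_decomposition:
  fixes W :: "complex^'n::finite^'n"
  assumes "pos_def_matrix W"
  shows "\<exists>x :: 'n \<Rightarrow> complex^'n. \<forall>i j. W $ i $ j = (\<Sum>k\<in>UNIV. x k $ i * cnj (x k $ j))"
  by (rule rank_one_decomposition_supported)
    (simp_all add: pos_def_form[OF assms] pos_def_hermitian[OF assms])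

text \<open>The trace is linear in \<open>W\<close>, and multiplying \<open>P\<close> by a rank one
  matrix built from \<open>x\<close> gives trace \<open>herm_prod x (P *v x)\<close>; the proof only
  reorders the triple sum.\<close>

lemma trace_mult_rank_one_sum:
  fixes P W :: "complex^'n::finite^'n"
  assumes "\<forall>i j. W $ i $ j = (\<Sum>k\<in>UNIV. x k $ i * cnj (x k $ j))"
  shows "trace (P ** W) = (\<Sum>k\<in>UNIV. herm_prod (x k) (P *v x k))"
proof -
  have "trace (P ** W)
      = (\<Sum>i\<in>UNIV. \<Sum>j\<in>UNIV. \<Sum>k\<in>UNIV. P $ i $ j * x k $ j * cnj (x k $ i))"
    by (simp add: trace_def matrix_matrix_mult_def assms sum_distrib_left mult_ac)
  also have "\<dots> = (\<Sum>i\<in>UNIV. \<Sum>k\<in>UNIV. \<Sum>j\<in>UNIV. P $ i $ j * x k $ j * cnj (x k $ i))"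
    by (intro sum.cong refl sum.swap)
  also have "\<dots> = (\<Sum>k\<in>UNIV. \<Sum>i\<in>UNIV. \<Sum>j\<in>UNIV. P $ i $ j * x k $ j * cnj (x k $ i))"
    by (rule sum.swap)
  finally show ?thesis
    by (simp add: herm_prod_def matrix_vector_mult_def sum_distrib_left mult_ac)
qed

section \<open>Inverses of positive definite matrices and traces of metrics\<close>

lemma matrix_inv_mult_vec:
  fixes G :: "complex^'n::finite^'n"
  assumes "det G \<noteq> 0"
  shows "G *v (matrix_inv G *v x) = x"
proof -
  have "G ** matrix_inv G = mat 1"
    using assms unfolding invertible_det_nz[symmetric] invertible_def matrix_inv_def
    by (rule someI2_ex) simp
  then show ?thesis by (simp add: matrix_vector_mul_assoc)
qed

text \<open>Substitute \<open>x = G *v y\<close> with \<open>y = matrix_inv G *v x\<close>. Reality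
  and positivity of the inverse form thus reduce to those of the form of \<open>G\<close>
  itself.\<close>

lemma herm_form_inv:
  fixes G :: "complex^'n::finite^'n"
  assumes "pos_def_matrix G"
  shows "herm_prod x (matrix_inv G *v x)
       = herm_prod (matrix_inv G *v x) (G *v (matrix_inv G *v x))"
  using herm_prod_adjoint[OF pos_def_hermitian[OF assms], of "matrix_inv G *v x" "matrix_inv G *v x"]
  by (simp only: matrix_inv_mult_vec[OF pos_def_det_nz[OF assms]])

text \<open>With \<open>y\<close> and \<open>z\<close> the images of \<open>x\<close> under the
  inverses of \<open>G\<close> and \<open>H\<close>, expand the nonnegative form of \<open>G\<close>
  at \<open>y - z\<close>. Its last term, the form of \<open>G\<close> at \<open>z\<close>, is at
  most the form of \<open>H\<close> at \<open>z\<close>, which is \<open>herm_prod x z\<close> and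
  absorbs one of the two cross terms.\<close>

lemma inverse_form_antimono:
  fixes G H :: "complex^'n::finite^'n"
  assumes G: "pos_def_matrix G" and H: "pos_def_matrix H"
    and le: "\<And>x. Re (herm_prod x (G *v x)) \<le> Re (herm_prod x (H *v x))"
  shows "Re (herm_prod x (matrix_inv H *v x)) \<le> Re (herm_prod x (matrix_inv G *v x))"
proof -
  define y where "y = matrix_inv G *v x"
  define z where "z = matrix_inv H *v x"
  have y: "G *v y = x" and z: "H *v z = x"
    using G H by (simp_all add: y_def z_def matrix_inv_mult_vec pos_def_det_nz)
  \<comment> \<open>Both pairings are values of a Hermitian form, so the order of the arguments does
    not matter and the two cross terms below coincide.\<close>
  have hz: "herm_prod z x = herm_prod x z" and hy: "herm_prod y x = herm_prod x y"
    using herm_form_inv[OF H, of x, folded z_def] herm_form_inv[OF G, of x, folded y_def]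
    unfolding y z by (auto intro: sym)
  have yGz: "herm_prod y (G *v z) = herm_prod x z"
    unfolding herm_prod_adjoint[OF pos_def_hermitian[OF G], symmetric] y ..
  have "0 \<le> Re (herm_prod (y - z) (G *v (y - z)))"
    by (rule pos_def_form_ge_0[OF G])
  also have "\<dots> = Re (herm_prod x y) - 2 * Re (herm_prod x z) + Re (herm_prod z (G *v z))"
    unfolding matrix_vector_mult_diff_distrib herm_prod_diff_left herm_prod_diff_right
      y yGz hz hy by simp
  also have "\<dots> \<le> Re (herm_prod x y) - Re (herm_prod x z)"
    using le[of z] unfolding z hz by simp
  finally show ?thesis by (simp add: y_def z_def)
qed

lemma trace_inv_antimono:
  fixes G H W :: "complex^'n::finite^'n"
  assumes G: "pos_def_matrix G" and H: "pos_def_matrix H" and W: "pos_def_matrix W"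
    and le: "\<And>x. Re (herm_prod x (G *v x)) \<le> Re (herm_prod x (H *v x))"
  shows "Re (trace (matrix_inv H ** W)) \<le> Re (trace (matrix_inv G ** W))"
proof -
  obtain x :: "'n \<Rightarrow> complex^'n" where "\<forall>i j. W $ i $ j = (\<Sum>k\<in>UNIV. x k $ i * cnj (x k $ j))"
    using pos_def_rank_one_decomposition[OF W] ..
  note tr = trace_mult_rank_one_sum[OF this]
  show ?thesis
    unfolding tr Re_sum by (intro sum_mono inverse_form_antimono assms)
qed

lemma trace_inv_pos:
  fixes G W :: "complex^'n::finite^'n"
  assumes G: "pos_def_matrix G" and W: "pos_def_matrix W"
  shows "0 < Re (trace (matrix_inv G ** W))" "Im (trace (matrix_inv G ** W)) = 0"
proof -
  obtain x :: "'n \<Rightarrow> complex^'n" where x: "\<forall>i j. W $ i $ j = (\<Sum>k\<in>UNIV. x k $ i * cnj (x k $ j))"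
    using pos_def_rank_one_decomposition[OF W] ..
  note tr = trace_mult_rank_one_sum[OF this]
  show "Im (trace (matrix_inv G ** W)) = 0"
    unfolding tr by (simp add: herm_form_inv[OF G] Im_herm_form[OF pos_def_hermitian[OF G]])
  \<comment> \<open>One nonzero summand makes the sum strictly positive. If all vanished,
    \<open>W\<close> would be zero, against positivity at the vector with all entries 1.\<close>
  have "\<exists>k. x k \<noteq> 0"
  proof (rule ccontr)
    assume "\<not> ?thesis"
    then have "W = 0" by (simp add: vec_eq_iff x)
    then show False using pos_def_form[OF W, of 1] by (simp add: herm_prod_def)
  qed
  then obtain k where k: "x k \<noteq> 0" by blast
  have "matrix_inv G *v x k \<noteq> 0"
    using k matrix_inv_mult_vec[OF pos_def_det_nz[OF G], of "x k"] by auto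
  then show "0 < Re (trace (matrix_inv G ** W))"
    unfolding tr Re_sum herm_form_inv[OF G]
    by (intro sum_pos2[of _ k] pos_def_form[OF G] pos_def_form_ge_0[OF G]) auto
qed

text \<open>Each quotient is the dimension divided by the trace of \<open>W\<close> with respect to
  the form. The trace is real and positive, so real parts commute with the division, and
  antitonicity of the trace passes through the reciprocal and \<open>ln\<close>.\<close>

lemma wedge_quotient_mono:
  fixes G H W :: "complex^'n::finite^'n"
  assumes G: "pos_def_matrix G" and H: "pos_def_matrix H" and W: "pos_def_matrix W"
    and le: "\<And>x. Re (herm_prod x (G *v x)) \<le> Re (herm_prod x (H *v x))"
  shows "ln (Re (wedge_power G / wedge_power1 W G)) \<le> ln (Re (wedge_power H / wedge_power1 W H))"
proof -
  have Re: "Re (wedge_power K / wedge_power1 W K) = CARD('n) / Re (trace (matrix_inv K ** W))"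
    if K: "pos_def_matrix K" for K :: "complex^'n^'n"
  proof -
    define r where "r = Re (trace (matrix_inv K ** W))"
    have "trace (matrix_inv K ** W) = of_real r"
      using trace_inv_pos[OF K W] by (simp add: complex_eq_iff r_def)
    then show ?thesis
      unfolding wedge_quotient_eq_trace[OF pos_def_det_nz[OF K]] r_def[symmetric]
      by (metis Re_complex_of_real of_real_divide of_real_of_nat_eq)
  qed
  show ?thesis
    unfolding Re[OF G] Re[OF H]
    using trace_inv_pos(1)[OF G W] trace_inv_pos(1)[OF H W] trace_inv_antimono[OF assms]
    by (subst ln_le_cancel_iff) (auto intro!: divide_left_mono)
qed

section \<open>Second derivatives at a maximum\<close>

text \<open>Along the line through \<open>z\<close> in direction \<open>x\<close> the first
  derivative vanishes at the maximum. A positive second derivative would make it positive just to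
  the right, so the function would rise above its maximum.\<close>

lemma second_directional_derivative_at_max:
  fixes f :: "'a::real_normed_vector \<Rightarrow> real"
  assumes U: "open U" "z \<in> U"
    and D: "\<And>y. y \<in> U \<Longrightarrow> (f has_derivative D y) (at y)"
    and E: "((\<lambda>y. D y x) has_derivative E) (at z)"
    and max: "\<And>y. y \<in> U \<Longrightarrow> f y \<le> f z"
  shows "E x \<le> 0"
proof (rule ccontr)
  assume "\<not> ?thesis"
  then have pos: "0 < E x" by simp
  define l where "l = (\<lambda>s. z + s *\<^sub>R x)"
  have l: "(l has_derivative (\<lambda>h. h *\<^sub>R x)) (at s)" for s
    unfolding l_def by (auto intro!: derivative_eq_intros)
  have "open (l -` U)"
    unfolding l_def by (intro open_vimage U continuous_intros)
  then obtain d where d: "0 < d" "\<And>s. \<bar>s\<bar> < d \<Longrightarrow> l s \<in> U"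
    using U(2) unfolding open_dist by (auto simp: l_def dist_real_def dest!: bspec[of _ _ 0])
  have g: "((f \<circ> l) has_real_derivative D (l s) x) (at s)" if "\<bar>s\<bar> < d" for s
  proof -
    have "linear (D (l s))"
      using D[OF d(2)[OF that]] by (simp add: has_derivative_linear)
    then have "D (l s) (h *\<^sub>R x) = D (l s) x * h" for h
      by (simp add: linear_scale)
    moreover have "((f \<circ> l) has_derivative (D (l s) \<circ> (\<lambda>h. h *\<^sub>R x))) (at s)"
      by (rule diff_chain_at[OF l D[OF d(2)[OF that]]])
    ultimately show ?thesis
      by (simp add: has_field_derivative_def o_def)
  qed
  have g': "((\<lambda>s. D (l s) x) has_real_derivative E x) (at 0)"
  proof -
    have "linear E" using E by (simp add: has_derivative_linear)
    then have "E (h *\<^sub>R x) = E x * h" for h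
      by (simp add: linear_scale)
    moreover have "(((\<lambda>y. D y x) \<circ> l) has_derivative (E \<circ> (\<lambda>h. h *\<^sub>R x))) (at 0)"
      by (rule diff_chain_at[OF l]) (use E in \<open>simp add: l_def\<close>)
    ultimately show ?thesis
      by (simp add: has_field_derivative_def o_def)
  qed
  have crit: "D (l 0) x = 0"
  proof (rule DERIV_local_max[OF g d(1)])
    show "\<forall>y. \<bar>0 - y\<bar> < d \<longrightarrow> (f \<circ> l) y \<le> (f \<circ> l) 0"
      using max d(2) by (simp add: l_def)
  qed (use d in simp)
  obtain e where e: "0 < e" "\<And>h. 0 < h \<Longrightarrow> h < e \<Longrightarrow> 0 < D (l h) x"
    using DERIV_pos_inc_right[OF g' pos] by (auto simp: crit)
  define h where "h = min d e / 2"
  have h: "0 < h" "h < d" "h < e" using d e by (auto simp: h_def min_def)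
  \<comment> \<open>The derivative is positive only for parameters strictly between \<open>0\<close>
    and \<open>h\<close>, since it vanishes at \<open>0\<close>; continuity on the closed interval
    covers the endpoints.\<close>
  have "(f \<circ> l) 0 < (f \<circ> l) h"
  proof (rule DERIV_pos_imp_increasing_open[OF h(1)])
    fix s assume "0 < s" "s < h"
    then show "\<exists>y. ((f \<circ> l) has_real_derivative y) (at s) \<and> 0 < y"
      using g[of s] e(2)[of s] h by auto
  next
    have "isCont (f \<circ> l) s" if "\<bar>s\<bar> < d" for s
      using g[OF that] by (rule DERIV_isCont)
    then show "continuous_on {0..h} (f \<circ> l)"
      using h by (intro continuous_at_imp_continuous_on) auto
  qed
  moreover have "(f \<circ> l) h \<le> (f \<circ> l) 0"
    using max[OF d(2)[of h]] h by (simp add: l_def)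
  ultimately show False by simp
qed

text \<open>The inner derivative is taken along \<open>y\<close> and the outer one along
  \<open>x\<close>, the order in which \<open>d_z i (d_zbar j f)\<close> nests its
  operators.\<close>

definition dir2 :: "(complex^'n \<Rightarrow> real) \<Rightarrow> complex^'n \<Rightarrow> complex^'n \<Rightarrow> complex^'n \<Rightarrow> real" where
  "dir2 f z x y = frechet_derivative (\<lambda>w. frechet_derivative f (at w) y) (at z) x"

text \<open>If \<open>B\<close> is the second derivative of a function, \<open>H\<close> is its matrix \<open>\<partial>\<^sup>2/\<partial>z\<^sub>i\<partial>zbar\<^sub>j\<close>. Symmetry of
  \<open>B\<close> is not used: the asymmetric part only contributes to the imaginary part of the form.\<close>

lemma bilinear_complex_form:
  fixes B :: "complex^'n::finite \<Rightarrow> complex^'n \<Rightarrow> real"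
  assumes B: "bilinear B"
  defines "H \<equiv> \<chi> i j. (complex_of_real (B (axis i 1) (axis j 1))
      + \<i> * of_real (B (axis i 1) (axis j \<i>))
      - \<i> * (of_real (B (axis i \<i>) (axis j 1)) + \<i> * of_real (B (axis i \<i>) (axis j \<i>)))) / 4"
  shows "4 * Re (\<Sum>i\<in>UNIV. \<Sum>j\<in>UNIV. H $ i $ j * x $ i * cnj (x $ j))
       = B x x + B (\<i> *s x) (\<i> *s x)"
proof -
  have expand: "B y y = (\<Sum>i\<in>UNIV. \<Sum>j\<in>UNIV.
        Re (y $ i) * Re (y $ j) * B (axis i 1) (axis j 1)
      + Re (y $ i) * Im (y $ j) * B (axis i 1) (axis j \<i>)
      + Im (y $ i) * Re (y $ j) * B (axis i \<i>) (axis j 1)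
      + Im (y $ i) * Im (y $ j) * B (axis i \<i>) (axis j \<i>))" for y
  proof -
    define e where "e = (\<lambda>i. Re (y $ i) *\<^sub>R axis i 1 + Im (y $ i) *\<^sub>R axis i \<i> :: complex^'n)"
    have "y = (\<Sum>i\<in>UNIV. e i)"
      by (simp add: e_def vec_eq_iff axis_def if_distrib[of "\<lambda>x. _ *\<^sub>R x"] sum.distrib
          complex_eq_iff cong: if_cong)
    then have "B y y = B (\<Sum>i\<in>UNIV. e i) (\<Sum>j\<in>UNIV. e j)" by simp
    also have "\<dots> = (\<Sum>i\<in>UNIV. \<Sum>j\<in>UNIV. B (e i) (e j))"
      by (simp add: bilinear_sum[OF B] sum.cartesian_product)
    also have "\<dots> = (\<Sum>i\<in>UNIV. \<Sum>j\<in>UNIV.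
        Re (y $ i) * Re (y $ j) * B (axis i 1) (axis j 1)
      + Re (y $ i) * Im (y $ j) * B (axis i 1) (axis j \<i>)
      + Im (y $ i) * Re (y $ j) * B (axis i \<i>) (axis j 1)
      + Im (y $ i) * Im (y $ j) * B (axis i \<i>) (axis j \<i>))"
      by (simp add: e_def bilinear_ladd[OF B] bilinear_radd[OF B] bilinear_lmul[OF B]
          bilinear_rmul[OF B] algebra_simps)
    finally show ?thesis .
  qed
  \<comment> \<open>The second bracket is the summand of \<open>expand\<close> at
    \<open>\<i> *s x\<close>, where \<open>Re\<close> becomes minus \<open>Im\<close> and
    \<open>Im\<close> becomes \<open>Re\<close>.\<close>
  have "4 * Re (H $ i $ j * x $ i * cnj (x $ j)) =
      (Re (x $ i) * Re (x $ j) * B (axis i 1) (axis j 1)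
      + Re (x $ i) * Im (x $ j) * B (axis i 1) (axis j \<i>)
      + Im (x $ i) * Re (x $ j) * B (axis i \<i>) (axis j 1)
      + Im (x $ i) * Im (x $ j) * B (axis i \<i>) (axis j \<i>))
      + (Im (x $ i) * Im (x $ j) * B (axis i 1) (axis j 1)
      - Im (x $ i) * Re (x $ j) * B (axis i 1) (axis j \<i>)
      - Re (x $ i) * Im (x $ j) * B (axis i \<i>) (axis j 1)
      + Re (x $ i) * Re (x $ j) * B (axis i \<i>) (axis j \<i>))" for i j
    by (simp add: H_def field_simps)
  then show ?thesis
    unfolding expand[of x] expand[of "\<i> *s x"] Re_sum sum_distrib_left
    by (simp add: sum.distrib sum_subtractf sum_negf)
qed

text \<open>Unfolding the Wirtinger operators gives the matrix of
  \<open>bilinear_complex_form\<close> for \<open>dir2 f z\<close>. This expresses the complex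
  Hessian by pure second directional derivatives, to which the maximum test applies.\<close>

lemma re_ddbar_form:
  fixes f :: "complex^'n::finite \<Rightarrow> real"
  assumes U: "open U" "z \<in> U"
    and D: "\<And>y. y \<in> U \<Longrightarrow> f differentiable (at y)"
    and D2: "\<And>x. (\<lambda>y. frechet_derivative f (at y) x) differentiable (at z)"
  shows "4 * Re (\<Sum>i\<in>UNIV. \<Sum>j\<in>UNIV.
        d_z i (d_zbar j (\<lambda>y. complex_of_real (f y))) z * x $ i * cnj (x $ j))
      = dir2 f z x x + dir2 f z (\<i> *s x) (\<i> *s x)"
proof -
  have dir2: "((\<lambda>y. frechet_derivative f (at y) w) has_derivative (\<lambda>x. dir2 f z x w)) (at z)" for w
    using D2[of w] unfolding dir2_def frechet_derivative_works by simp
  have bil: "bilinear (dir2 f z)"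
    unfolding bilinear_def
  proof safe
    show "linear (\<lambda>x. dir2 f z x w)" for w
      using dir2 by (rule has_derivative_linear)
    \<comment> \<open>The first derivative is linear in its direction at every point near
      \<open>z\<close>, so uniqueness of the derivative carries this linearity over to the second
      derivative.\<close>
    show "linear (dir2 f z w)" for w
    proof (rule linearI)
      fix a b :: "complex^'n" and r :: real
      have lin: "linear (frechet_derivative f (at y))" if "y \<in> U" for y
        using D[OF that] by (rule linear_frechet_derivative)
      have "((\<lambda>y. frechet_derivative f (at y) (a + b)) has_derivative
          (\<lambda>x. dir2 f z x a + dir2 f z x b)) (at z)"
        by (rule has_derivative_transform_within_open[OF has_derivative_add[OF dir2 dir2] U])
          (simp add: linear_add[OF lin])
      from has_derivative_unique[OF dir2 this]
      show "dir2 f z w (a + b) = dir2 f z w a + dir2 f z w b" by metis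
      have "((\<lambda>y. frechet_derivative f (at y) (r *\<^sub>R a)) has_derivative
          (\<lambda>x. r *\<^sub>R dir2 f z x a)) (at z)"
        by (rule has_derivative_transform_within_open[OF has_derivative_scaleR_right[OF dir2] U])
          (simp add: linear_scale[OF lin])
      from has_derivative_unique[OF dir2 this]
      show "dir2 f z w (r *\<^sub>R a) = r *\<^sub>R dir2 f z w a" by metis
    qed
  qed
  \<comment> \<open>The formula is needed on all of \<open>U\<close>, not just at \<open>z\<close>,
    because \<open>d_z\<close> differentiates it again.\<close>
  have zbar: "d_zbar j (\<lambda>y. complex_of_real (f y)) y =
      (of_real (frechet_derivative f (at y) (axis j 1))
        + \<i> * of_real (frechet_derivative f (at y) (axis j \<i>))) / 2" if "y \<in> U" for y j
  proof -
    have "((\<lambda>y. complex_of_real (f y)) has_derivative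
        (\<lambda>x. of_real (frechet_derivative f (at y) x))) (at y)"
      using D[OF that] unfolding frechet_derivative_works by (rule has_derivative_of_real)
    from frechet_derivative_at[OF this, symmetric] show ?thesis
      by (simp add: d_zbar_def)
  qed
  have "(d_zbar j (\<lambda>y. complex_of_real (f y)) has_derivative
      (\<lambda>x. (of_real (dir2 f z x (axis j 1)) + \<i> * of_real (dir2 f z x (axis j \<i>))) / 2)) (at z)" for j
  proof (rule has_derivative_transform_within_open[OF _ U])
    show "((\<lambda>y. (of_real (frechet_derivative f (at y) (axis j 1))
        + \<i> * of_real (frechet_derivative f (at y) (axis j \<i>))) / 2) has_derivative
      (\<lambda>x. (of_real (dir2 f z x (axis j 1)) + \<i> * of_real (dir2 f z x (axis j \<i>))) / 2)) (at z)"
      unfolding divide_inverse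
      by (intro has_derivative_mult_left has_derivative_add has_derivative_mult_right
          has_derivative_of_real dir2)
  qed (simp add: zbar)
  note fd = frechet_derivative_at[OF this, symmetric]
  have "d_z i (d_zbar j (\<lambda>y. complex_of_real (f y))) z =
      (complex_of_real (dir2 f z (axis i 1) (axis j 1))
      + \<i> * of_real (dir2 f z (axis i 1) (axis j \<i>))
      - \<i> * (of_real (dir2 f z (axis i \<i>) (axis j 1))
             + \<i> * of_real (dir2 f z (axis i \<i>) (axis j \<i>)))) / 4" for i j
    unfolding d_z_def fd by (simp add: field_simps)
  then show ?thesis
    using bilinear_complex_form[OF bil, of x] by (simp only: vec_lambda_beta)
qed

text \<open>The second derivative test for \<open>f - g\<close> is applied along \<open>x\<close>
  and along \<open>\<i> *s x\<close>, and the two inequalities are added.\<close>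

lemma ddbar_form_le_at_max:
  fixes f g :: "complex^'n::finite \<Rightarrow> real"
  assumes U: "open U" "z \<in> U"
    and f: "\<And>y. y \<in> U \<Longrightarrow> f differentiable (at y)"
      "\<And>x. (\<lambda>y. frechet_derivative f (at y) x) differentiable (at z)"
    and g: "\<And>y. y \<in> U \<Longrightarrow> g differentiable (at y)"
      "\<And>x. (\<lambda>y. frechet_derivative g (at y) x) differentiable (at z)"
    and max: "\<And>y. y \<in> U \<Longrightarrow> f y - g y \<le> f z - g z"
  shows "Re (\<Sum>i\<in>UNIV. \<Sum>j\<in>UNIV.
        d_z i (d_zbar j (\<lambda>y. complex_of_real (f y))) z * x $ i * cnj (x $ j))
    \<le> Re (\<Sum>i\<in>UNIV. \<Sum>j\<in>UNIV.
        d_z i (d_zbar j (\<lambda>y. complex_of_real (g y))) z * x $ i * cnj (x $ j))"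
proof -
  have le: "dir2 f z w w - dir2 g z w w \<le> 0" for w
    unfolding dir2_def
  proof (rule second_directional_derivative_at_max[OF U, where f = "\<lambda>y. f y - g y" and x = w
        and D = "\<lambda>y x. frechet_derivative f (at y) x - frechet_derivative g (at y) x"
        and E = "\<lambda>x. frechet_derivative (\<lambda>y. frechet_derivative f (at y) w) (at z) x
          - frechet_derivative (\<lambda>y. frechet_derivative g (at y) w) (at z) x"])
    show "((\<lambda>y. f y - g y) has_derivative
        (\<lambda>x. frechet_derivative f (at y) x - frechet_derivative g (at y) x)) (at y)" if "y \<in> U" for y
      using f(1)[OF that] g(1)[OF that] unfolding frechet_derivative_works by (rule has_derivative_diff)
    show "((\<lambda>y. frechet_derivative f (at y) w - frechet_derivative g (at y) w) has_derivative
        (\<lambda>x. frechet_derivative (\<lambda>y. frechet_derivative f (at y) w) (at z) x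
          - frechet_derivative (\<lambda>y. frechet_derivative g (at y) w) (at z) x)) (at z)"
      using f(2) g(2) unfolding frechet_derivative_works by (rule has_derivative_diff)
  qed (rule max)
  show ?thesis
    using re_ddbar_form[OF U f, of x] re_ddbar_form[OF U g, of x] le[of x] le[of "\<i> *s x"] by linarith
qed

section \<open>Regularity extracted from local smooth extensions\<close>

lemma smooth_on_open_twice_differentiable:
  assumes "smooth_on S f" "open S" "z \<in> S"
  obtains U where "open U" "z \<in> U" "\<And>y. y \<in> U \<Longrightarrow> f differentiable (at y)"
    "\<And>x. (\<lambda>y. frechet_derivative f (at y) x) differentiable (at z)"
proof -
  obtain W g where W: "open W" "z \<in> W" "\<And>k. Ck_on k W g" "\<And>y. y \<in> W \<inter> S \<Longrightarrow> g y = f y"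
    using assms(1)[unfolded smooth_on_def, rule_format, OF assms(3)] by blast
  define U where "U = W \<inter> S"
  have U: "open U" "z \<in> U" using W assms by (auto simp: U_def)
  \<comment> \<open>Membership in \<open>Ck_on 2\<close> unfolds to differentiability of
    \<open>g\<close> and of its directional derivatives. On the open set \<open>U\<close> the
    extension \<open>g\<close> agrees with \<open>f\<close>, so both facts transfer.\<close>
  have g: "g differentiable (at y)" "(\<lambda>y. frechet_derivative g (at y) x) differentiable (at y)"
    if "y \<in> U" for y x
    using W(3)[of 2] that by (auto simp: U_def numeral_2_eq_2)
  have f: "(f has_derivative frechet_derivative g (at y)) (at y)" if "y \<in> U" for y
    using g(1)[OF that] unfolding frechet_derivative_works
    by (rule has_derivative_transform_within_open[OF _ U(1) that]) (use W(4) in \<open>simp add: U_def\<close>)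
  have eq: "frechet_derivative f (at y) = frechet_derivative g (at y)" if "y \<in> U" for y
    using frechet_derivative_at[OF f[OF that]] by simp
  show ?thesis
  proof (rule that[OF U])
    show "f differentiable (at y)" if "y \<in> U" for y
      using f[OF that] by (auto simp: differentiable_def)
    show "(\<lambda>y. frechet_derivative f (at y) x) differentiable (at z)" for x
    proof -
      obtain D where "((\<lambda>y. frechet_derivative g (at y) x) has_derivative D) (at z)"
        using g(2)[OF U(2), of x] by (auto simp: differentiable_def)
      then have "((\<lambda>y. frechet_derivative f (at y) x) has_derivative D) (at z)"
        by (rule has_derivative_transform_within_open[OF _ U]) (simp add: eq)
      then show ?thesis by (auto simp: differentiable_def)
    qed
  qed
qed

lemma smooth_on_imp_continuous_on:
  assumes "smooth_on S f"
  shows "continuous_on S f"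
  unfolding continuous_on_eq_continuous_within
proof
  fix x assume x: "x \<in> S"
  then obtain W g where W: "open W" "x \<in> W" "Ck_on 0 W g" "\<And>y. y \<in> W \<inter> S \<Longrightarrow> g y = f y"
    using assms[unfolded smooth_on_def, rule_format, OF x] by blast
  have "continuous_on (W \<inter> S) g"
    using W(3) by (auto intro: continuous_on_subset)
  then have "continuous_on (W \<inter> S) f"
    using W(4) by (rule continuous_on_eq)
  then have "continuous (at x within W \<inter> S) f"
    using W x by (auto simp: continuous_on_eq_continuous_within)
  moreover have "at x within S = at x within W \<inter> S"
    by (rule at_within_nhd[OF W(2,1)]) auto
  ultimately show "continuous (at x within S) f" by simp
qed

text \<open>The local extension is differentiable in a full neighbourhood even when \<open>t\<close>
  is an endpoint of \<open>I\<close>, so the chain rule along the time line yields the derivative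
  relative to \<open>I\<close>.\<close>

lemma smooth_on_line_differentiable:
  fixes f :: "'a::real_normed_vector \<times> real \<Rightarrow> real"
  assumes "smooth_on (V \<times> I) f" "z \<in> V" "t \<in> I"
  shows "(\<lambda>s. f (z, s)) differentiable (at t within I)"
proof -
  obtain W g where W: "open W" "(z, t) \<in> W" "Ck_on 1 W g" "\<And>y. y \<in> W \<inter> V \<times> I \<Longrightarrow> g y = f y"
    using assms(1)[unfolded smooth_on_def, rule_format, OF SigmaI[OF assms(2,3)]] by blast
  have "g differentiable (at (z, t))" using W by simp
  then have "(g has_derivative frechet_derivative g (at (z, t))) (at (z, t))"
    by (simp add: frechet_derivative_works)
  moreover have "((\<lambda>s. (z, s)) has_derivative (\<lambda>h. (0, h))) (at t within I)"
    by (auto intro!: derivative_eq_intros)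
  ultimately have "((\<lambda>s. g (z, s)) has_derivative (\<lambda>h. frechet_derivative g (at (z, t)) (0, h)))
      (at t within I)"
    by (rule has_derivative_compose[rotated])
  moreover have "open ((\<lambda>s. (z, s)) -` W)"
    by (intro open_vimage W continuous_intros)
  then obtain d where "0 < d" "\<And>s. dist s t < d \<Longrightarrow> (z, s) \<in> W"
    using W(2) unfolding open_dist by auto
  ultimately have "((\<lambda>s. f (z, s)) has_derivative (\<lambda>h. frechet_derivative g (at (z, t)) (0, h)))
      (at t within I)"
    by (elim has_derivative_transform_within) (use assms W(4) in auto)
  then show ?thesis by (auto simp: differentiable_def)
qed

text \<open>Difference quotients from the left have nonpositive numerator and negative denominator.
  Since \<open>t\<close> is positive, such quotients exist, also at \<open>t = T\<close>, where the
  derivative is one-sided.\<close>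

lemma vector_derivative_at_last_max:
  fixes w :: "real \<Rightarrow> real"
  assumes w: "(w has_vector_derivative d) (at t within {0..T})"
    and t: "0 < t" "t \<le> T" and max: "\<And>s. s \<in> {0..T} \<Longrightarrow> w s \<le> w t"
  shows "0 \<le> d"
proof -
  have "((\<lambda>s. (w s - w t) / (s - t)) \<longlongrightarrow> d) (at t within {0..T})"
    using w by (simp add: has_real_derivative_iff_has_vector_derivative[symmetric]
        has_field_derivative_iff)
  then have "((\<lambda>s. (w s - w t) / (s - t)) \<longlongrightarrow> d) (at t within {0..<t})"
    by (rule tendsto_within_subset) (use t in auto)
  moreover have "at t within {0..<t} \<noteq> bot"
    using t by (simp add: at_within_eq_bot_iff)
  moreover have "eventually (\<lambda>s. 0 \<le> (w s - w t) / (s - t)) (at t within {0..<t})"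
    unfolding eventually_at_filter using max t
    by (intro always_eventually) (auto intro!: divide_nonpos_neg)
  ultimately show ?thesis by (blast intro: tendsto_lowerbound)
qed


section \<open>Comparison on the manifold\<close>

context
  fixes A :: "('m::{t2_space,second_countable_topology}, 'n::finite) chart set"
  assumes A: "complex_atlas A"
begin

lemma chart_at_mem: "chart_at A p \<in> A" "p \<in> fst (chart_at A p)"
proof -
  have "p \<in> (\<Union>c\<in>A. fst c)" using A by (simp add: complex_atlas_def)
  then have "\<exists>c. c \<in> A \<and> p \<in> fst c" by blast
  from someI_ex[OF this] show "chart_at A p \<in> A" "p \<in> fst (chart_at A p)"
    by (simp_all add: chart_at_def)
qed

lemma chart_props:
  assumes "c \<in> A"
  shows "open (fst c)" "open (chart_image c)" "continuous_on (fst c) (snd c)"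
    "p \<in> fst c \<Longrightarrow> chart_inv c (snd c p) = p" "p \<in> fst c \<Longrightarrow> snd c p \<in> chart_image c"
  using A assms by (auto simp: complex_atlas_def homeomorphism_def chart_image_def)

text \<open>Joint continuity provides the space-time maximum. Continuity is local, so it is checked
  in a chart around each point, where composing with the coordinate map undoes
  \<open>chart_inv\<close>.\<close>

lemma smooth_time_fun_continuous:
  assumes u: "smooth_time_fun A T u"
  shows "continuous_on (UNIV \<times> {0..T}) (\<lambda>(p, t). u p t)"
  unfolding continuous_on_eq_continuous_within
proof
  fix x :: "'m \<times> real" assume x: "x \<in> UNIV \<times> {0..T}"
  define c where "c = chart_at A (fst x)"
  have c: "c \<in> A" "fst x \<in> fst c"
    unfolding c_def by (rule chart_at_mem)+
  have "continuous_on (chart_image c \<times> {0..T}) (\<lambda>(z, t). u (chart_inv c z) t)"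
    using u c(1) by (intro smooth_on_imp_continuous_on) (simp add: smooth_time_fun_def)
  moreover have "continuous_on (fst c \<times> {0..T}) (\<lambda>y. (snd c (fst y), snd y))"
    by (intro continuous_intros continuous_on_compose2[OF chart_props(3)[OF c(1)]]) auto
  ultimately have "continuous_on (fst c \<times> {0..T})
      (\<lambda>y. (\<lambda>(z, t). u (chart_inv c z) t) (snd c (fst y), snd y))"
    by (rule continuous_on_compose2) (use chart_props(5)[OF c(1)] in auto)
  then have "continuous_on (fst c \<times> {0..T}) (\<lambda>(p, t). u p t)"
    by (rule continuous_on_eq) (use chart_props(4)[OF c(1)] in auto)
  then have "continuous (at x within fst c \<times> {0..T}) (\<lambda>(p, t). u p t)"
    using x c(2) by (auto simp: continuous_on_eq_continuous_within)
  moreover have "at x within UNIV \<times> {0..T} = at x within fst c \<times> {0..T}"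
    by (rule at_within_nhd[of _ "fst c \<times> UNIV"])
      (use c chart_props(1)[OF c(1)] in \<open>auto intro: open_Times simp: mem_Times_iff\<close>)
  ultimately show "continuous (at x within UNIV \<times> {0..T}) (\<lambda>(p, t). u p t)" by simp
qed

lemma smooth_time_fun_time_deriv:
  assumes "smooth_time_fun A T u" "t \<in> {0..T}"
  shows "(u p has_vector_derivative time_deriv T u p t) (at t within {0..T})"
proof -
  define c where "c = chart_at A p"
  have c: "c \<in> A" "p \<in> fst c"
    unfolding c_def by (rule chart_at_mem)+
  have "smooth_on (chart_image c \<times> {0..T}) (\<lambda>(z, t). u (chart_inv c z) t)"
    using assms(1) c(1) by (simp add: smooth_time_fun_def)
  from smooth_on_line_differentiable[OF this chart_props(5)[OF c] assms(2)]
  have "u p differentiable (at t within {0..T})"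
    by (simp add: chart_props(4)[OF c])
  then show ?thesis
    unfolding time_deriv_def by (simp add: vector_derivative_works)
qed

text \<open>Both sides are computed in the same chart at \<open>p\<close>, where \<open>X\<close>
  and \<open>F\<close> contribute equally. The maximum orders the two complex Hessians, hence the
  two positive forms, and the wedge quotient is monotone in the form.\<close>

lemma Q_op_le_at_max:
  assumes \<omega>: "hermitian_metric A \<omega>"
    and f: "f \<in> admissible A X" and g: "g \<in> admissible A X"
    and max: "\<And>q. f q - g q \<le> f p - g p"
  shows "Q_op A \<omega> X F f p \<le> Q_op A \<omega> X F g p"
proof -
  define c where "c = chart_at A p"
  define z where "z = snd c p"
  have c: "c \<in> A" "p \<in> fst c"
    unfolding c_def by (rule chart_at_mem)+
  have z: "z \<in> chart_image c" "chart_inv c z = p"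
    unfolding z_def using chart_props(4,5)[OF c] by auto
  have sm: "smooth_on (chart_image c) (\<lambda>z. f (chart_inv c z))"
    "smooth_on (chart_image c) (\<lambda>z. g (chart_inv c z))"
    using f g c(1) by (simp_all add: admissible_def smooth_fun_def o_def)
  obtain U where U: "open U" "z \<in> U"
      "\<And>y. y \<in> U \<Longrightarrow> (\<lambda>z. f (chart_inv c z)) differentiable (at y)"
      "\<And>x. (\<lambda>y. frechet_derivative (\<lambda>z. f (chart_inv c z)) (at y) x) differentiable (at z)"
    using smooth_on_open_twice_differentiable[OF sm(1) chart_props(2)[OF c(1)] z(1)] by blast
  obtain V where V: "open V" "z \<in> V"
      "\<And>y. y \<in> V \<Longrightarrow> (\<lambda>z. g (chart_inv c z)) differentiable (at y)"
      "\<And>x. (\<lambda>y. frechet_derivative (\<lambda>z. g (chart_inv c z)) (at y) x) differentiable (at z)"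
    using smooth_on_open_twice_differentiable[OF sm(2) chart_props(2)[OF c(1)] z(1)] by blast
  \<comment> \<open>The maximum is global, so the inequality holds at \<open>chart_inv c y\<close>
    for every \<open>y\<close> in the neighbourhood, inside the chart image or not.\<close>
  have ddbar: "Re (\<Sum>i\<in>UNIV. \<Sum>j\<in>UNIV. i_ddbar f c p $ i $ j * x $ i * cnj (x $ j))
      \<le> Re (\<Sum>i\<in>UNIV. \<Sum>j\<in>UNIV. i_ddbar g c p $ i $ j * x $ i * cnj (x $ j))"
    for x :: "complex^'n"
    unfolding i_ddbar_def vec_lambda_beta z_def[symmetric]
    by (rule ddbar_form_le_at_max[of "U \<inter> V"]) (use U V z max in auto)
  have G: "pos_def_matrix (form_add_ddbar X f c p)" "pos_def_matrix (form_add_ddbar X g c p)"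
    and W: "pos_def_matrix (\<omega> c p)"
    using f g \<omega> c by (simp_all add: admissible_def positive_form11_def hermitian_metric_def)
  have "Re (herm_prod x (form_add_ddbar X f c p *v x))
      \<le> Re (herm_prod x (form_add_ddbar X g c p *v x))" for x
    unfolding herm_form_eq form_add_ddbar_def
    using ddbar[of "\<chi> i. cnj (x $ i)"]
    by (simp only: plus_complex.simps vector_add_component distrib_right sum.distrib add_left_mono)
  from wedge_quotient_mono[OF G W this] show ?thesis
    by (simp add: Q_op_def Let_def c_def)
qed

end


theorem proposition3p1:
  fixes A :: "('m::{t2_space,second_countable_topology}, 'n::finite) chart set"
    and \<omega> X :: "('m, 'n) form11"
    and F :: "'m \<Rightarrow> real"
    and T :: real
    and u v :: "'m \<Rightarrow> real \<Rightarrow> real"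
  assumes "complex_atlas A"
    and "compact (UNIV :: 'm set)"
    and "connected (UNIV :: 'm set)"
    and "CARD('n) \<ge> 2"
    and "hermitian_metric A \<omega>"
    and "hermitian_metric A X"
    and "smooth_fun A F"
    and "0 < T"
    and "smooth_time_fun A T u"
    and "smooth_time_fun A T v"
    and "\<forall>t\<in>{0..T}. (\<lambda>p. u p t) \<in> admissible A X"
    and "\<forall>t\<in>{0..T}. (\<lambda>p. v p t) \<in> admissible A X"
    and "\<forall>p. \<forall>t\<in>{0..T}. time_deriv T u p t \<le> Q_op A \<omega> X F (\<lambda>q. u q t) p"
    and "\<forall>p. \<forall>t\<in>{0..T}. time_deriv T v p t \<ge> Q_op A \<omega> X F (\<lambda>q. v q t) p"
    and "\<forall>p. u p 0 \<le> v p 0"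
  shows "\<forall>p. \<forall>t\<in>{0..T}. u p t \<le> v p t"
proof (rule ccontr)
  note A = assms(1) and T = \<open>0 < T\<close>
  assume "\<not> ?thesis"
  then obtain q s where qs: "s \<in> {0..T}" "v q s < u q s" by (auto simp: not_le)
  \<comment> \<open>Half the gap at \<open>(q, s)\<close> divided by \<open>T\<close>: the penalty
    \<open>\<epsilon> * s\<close> is then at most half the gap, so \<open>w q s\<close> stays
    positive.\<close>
  define \<epsilon> where "\<epsilon> = (u q s - v q s) / (2 * T)"
  have \<epsilon>: "0 < \<epsilon>" using qs T by (simp add: \<epsilon>_def)
  define w where "w = (\<lambda>p t. u p t - v p t - \<epsilon> * t)"
  have "continuous_on (UNIV \<times> {0..T}) (\<lambda>y. (\<lambda>(p, t). u p t) y - (\<lambda>(p, t). v p t) y - \<epsilon> * snd y)"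
    by (intro continuous_intros smooth_time_fun_continuous[OF A] assms)
  then have "continuous_on (UNIV \<times> {0..T}) (\<lambda>(p, t). w p t)"
    by (simp add: w_def case_prod_unfold)
  moreover have "compact ((UNIV :: 'm set) \<times> {0..T})"
    using assms(2) by (intro compact_Times compact_Icc)
  moreover have "(UNIV :: 'm set) \<times> {0..T} \<noteq> {}" using T by auto
  ultimately obtain y where y: "y \<in> UNIV \<times> {0..T}"
    "\<forall>x\<in>UNIV \<times> {0..T}. (\<lambda>(p, t). w p t) x \<le> (\<lambda>(p, t). w p t) y"
    using continuous_attains_sup[of "(UNIV :: 'm set) \<times> {0..T}"] by blast
  obtain p t where "y = (p, t)" by (cases y)
  with y have pt: "t \<in> {0..T}" "\<And>q s. s \<in> {0..T} \<Longrightarrow> w q s \<le> w p t" by auto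
  have "\<epsilon> * s \<le> \<epsilon> * T" using qs \<epsilon> by (intro mult_left_mono) auto
  also have "\<dots> < u q s - v q s" using qs T by (simp add: \<epsilon>_def)
  finally have "0 < w q s" by (simp add: w_def)
  with pt(2)[OF qs(1), of q] have "0 < w p t" by simp
  \<comment> \<open>The initial inequality excludes \<open>t = 0\<close>, so the maximum can be
    compared with earlier times.\<close>
  moreover have "w p 0 \<le> 0" using assms(15) by (simp add: w_def)
  ultimately have t: "0 < t" using pt(1) by (cases "t = 0") auto
  have "(w p has_vector_derivative (time_deriv T u p t - time_deriv T v p t - \<epsilon> * 1))
      (at t within {0..T})"
    unfolding w_def
    by (intro has_vector_derivative_diff has_vector_derivative_mult_right
        has_vector_derivative_id smooth_time_fun_time_deriv[OF A] assms(9,10) pt(1))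
  from vector_derivative_at_last_max[OF this t _ pt(2)] pt(1)
  have "\<epsilon> \<le> time_deriv T u p t - time_deriv T v p t" by simp
  \<comment> \<open>At the fixed time \<open>t\<close> the penalty is constant in space, so
    \<open>p\<close> also maximizes \<open>u - v\<close> over the manifold.\<close>
  moreover have "Q_op A \<omega> X F (\<lambda>q. u q t) p \<le> Q_op A \<omega> X F (\<lambda>q. v q t) p"
  proof (rule Q_op_le_at_max[OF A assms(5)])
    show "u q t - v q t \<le> u p t - v p t" for q
      using pt(2)[OF pt(1), of q] by (simp add: w_def)
  qed (use assms(11,12) pt(1) in auto)
  \<comment> \<open>The two differential inequalities bound the difference of time derivatives by
    the difference of the operators, which is at most 0, while it is at least
    \<open>\<epsilon>\<close>.\<close>
  ultimately show False
    using assms(13)[rule_format, of t p] assms(14)[rule_format, of t p] pt(1) \<epsilon> by linarith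
qed

end
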